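(* Suppose that one local space-time block has $N_b$ unknown coefficients, and assume that the left-hand-side block operator is reusable on every uniform block. Let $R=N_g/N_b$, where $N_g$ is the unknown count of the global solve. Let $F(N)$ denote the one-time cost of factorising an $N$-unknown operator, and let $A(N)$ denote the cost of applying that factorisation to one right-hand side. Compare $L$ uniform block solves, reusing a single block factorisation, against one global solve with $N_g=RN_b$ unknowns. The respective costs are $$C_{\mathrm{block}}(N_b,L)=F(N_b)+L\,A(N_b),\qquad C_{\mathrm{global}}(N_b,R)=F(RN_b)+A(RN_b).$$ If the factorisation and application costs are $F(N)=c_FN^\alpha$ and $A(N)=c_AN^\beta$, with $c_F,c_A>0$ and $\alpha\ge\beta$, the cost ratio is $$\frac{C_{\mathrm{global}}(N_b,R)}{C_{\mathrm{block}}(N_b,L)}=\frac{c_FR^\alpha N_b^\alpha+c_AR^\beta N_b^\beta}{c_FN_b^\alpha+c_ALN_b^\beta}.$$ When both global and block systems are refined with fixed coefficient ratio $R$ and fixed block count $L$ (that is, $N_b\to\infty$ with $R$ and $L$ fixed), and $\alpha>\beta$, this ratio tends to $R^\alpha$.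
   Context: A blocked solve divides the time interval into $L$ uniform blocks and solves them sequentially. "Reusable" means the same left-hand-side operator occurs on every block, so it is factorised once and the factorisation is applied to one new right-hand side per block. The global solve factorises its operator once and applies the factorisation to one right-hand side. Only factorisation and application costs are counted. *)

theory Defs
  imports Complex_Main
begin

text \<open>
  A sequential solve is recorded by the list of left-hand-side operators of the successive
  systems, one right-hand side each. An operator is factorised once, however often it occurs in
  the list, and its factorisation is applied once for every occurrence; nothing else is counted.
  Operators are kept abstract because the costs depend on an operator only through its
  number of unknowns, \<open>unknowns P\<close>.
\<close>

definition solve_cost ::
  "(real \<Rightarrow> real) \<Rightarrow> (real \<Rightarrow> real) \<Rightarrow> ('op \<Rightarrow> nat) \<Rightarrow> 'op list \<Rightarrow> real" where
  "solve_cost F A unknowns ops =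
     (\<Sum>P\<in>set ops. F (real (unknowns P))) + (\<Sum>P\<leftarrow>ops. A (real (unknowns P)))"

definition reusable :: "'op list \<Rightarrow> bool" where
  "reusable ops \<longleftrightarrow> (\<forall>P\<in>set ops. \<forall>Q\<in>set ops. P = Q)"

text \<open>
  Cost functions take real arguments, so that \<open>R * N\<^sub>b\<close> makes sense for every real
  ratio \<open>R\<close>.
\<close>

definition C_block :: "(real \<Rightarrow> real) \<Rightarrow> (real \<Rightarrow> real) \<Rightarrow> real \<Rightarrow> nat \<Rightarrow> real" where
  "C_block F A N\<^sub>b L = F N\<^sub>b + real L * A N\<^sub>b"

definition C_global :: "(real \<Rightarrow> real) \<Rightarrow> (real \<Rightarrow> real) \<Rightarrow> real \<Rightarrow> real \<Rightarrow> real" where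
  "C_global F A N\<^sub>b R = F (R * N\<^sub>b) + A (R * N\<^sub>b)"

end

theory Submission
  imports Defs
begin

text \<open>
  In the ratio of the power-law costs, numerator and denominator are divided by
  \<open>N powr \<alpha>\<close>; the application terms then carry the factor
  \<open>N powr (\<beta> - \<alpha>)\<close>, which vanishes in the limit when \<open>\<alpha> > \<beta>\<close>, so only the
  factorisation terms survive.
\<close>

text \<open>Reusability together with \<open>ops \<noteq> []\<close> collapses
  \<open>set ops\<close> to a singleton, so the sum over the set charges one factorisation, while
  the sum over the list still charges one application per occurrence.\<close>

lemma solve_cost_reusable:
  assumes "reusable ops" and "ops \<noteq> []" and "\<forall>P\<in>set ops. unknowns P = n"
  shows "solve_cost F A unknowns ops = C_block F A (real n) (length ops)"
proof -
  obtain P where "P \<in> set ops"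
    using assms(2) by (cases ops) auto
  with assms(1) have "set ops = {P}"
    by (auto simp: reusable_def)
  then have "(\<Sum>Q\<in>set ops. F (real (unknowns Q))) = F (real n)"
    using assms(3) by simp
  \<comment> \<open>The application costs become a constant list, which \<open>sum_list_triv\<close>
    evaluates. Deleting \<open>map_eq_conv\<close> below keeps this equation usable as a rewrite
    rule instead of being turned into a pointwise statement.\<close>
  moreover have "map (\<lambda>Q. A (real (unknowns Q))) ops = map (\<lambda>_. A (real n)) ops"
    using assms(3) by simp
  ultimately show ?thesis
    by (simp add: solve_cost_def C_block_def sum_list_triv del: map_eq_conv)
qed

lemma solve_cost_single:
  "solve_cost F A unknowns [P] = F (real (unknowns P)) + A (real (unknowns P))"
  by (simp add: solve_cost_def)

lemma cost_ratio_power: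
  fixes F A :: "real \<Rightarrow> real"
  assumes "\<forall>N>0. F N = c\<^sub>F * N powr \<alpha>" and "\<forall>N>0. A N = c\<^sub>A * N powr \<beta>"
    and "R > 0" and "N > 0"
  shows "C_global F A N R / C_block F A N L =
    (c\<^sub>F * R powr \<alpha> * N powr \<alpha> + c\<^sub>A * R powr \<beta> * N powr \<beta>) /
    (c\<^sub>F * N powr \<alpha> + c\<^sub>A * real L * N powr \<beta>)"
  using assms by (simp add: C_global_def C_block_def powr_mult mult_ac)

text \<open>Only the leading coefficients reach the limit, so \<open>b\<close> and \<open>d\<close>
  are arbitrary; \<open>c \<noteq> 0\<close> keeps the limit of the rescaled denominator away from
  zero.\<close>

lemma tendsto_powr_ratio_at_top:
  fixes a b c d \<alpha> \<beta> :: real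
  assumes "c \<noteq> 0" and "\<beta> < \<alpha>"
  shows "((\<lambda>N. (a * N powr \<alpha> + b * N powr \<beta>) / (c * N powr \<alpha> + d * N powr \<beta>))
    \<longlongrightarrow> a / c) at_top"
proof -
  have "((\<lambda>N::real. N powr (\<beta> - \<alpha>)) \<longlongrightarrow> 0) at_top"
    using assms(2) by (intro tendsto_neg_powr filterlim_ident) simp
  then have "((\<lambda>N. (a + b * N powr (\<beta> - \<alpha>)) / (c + d * N powr (\<beta> - \<alpha>)))
      \<longlongrightarrow> (a + b * 0) / (c + d * 0)) at_top"
    using assms(1) by (intro tendsto_intros) auto
  moreover have "\<forall>\<^sub>F N in at_top.
      (a + b * N powr (\<beta> - \<alpha>)) / (c + d * N powr (\<beta> - \<alpha>)) =
      (a * N powr \<alpha> + b * N powr \<beta>) / (c * N powr \<alpha> + d * N powr \<beta>)"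
    using eventually_gt_at_top[of 0]
  proof eventually_elim
    case (elim N)
    \<comment> \<open>For \<open>N > 0\<close> the factor \<open>N powr \<alpha>\<close> is nonzero,
      so pulling it out of numerator and denominator lets it cancel.\<close>
    have scale: "x * N powr \<alpha> + y * N powr \<beta> = (x + y * N powr (\<beta> - \<alpha>)) * N powr \<alpha>" for x y
      using elim by (simp add: powr_diff algebra_simps)
    show ?case
      using elim by (simp add: scale)
  qed
  ultimately show ?thesis
    by (simp add: tendsto_cong)
qed

text \<open>The first conjunct ties the two cost formulas to the counting model, with natural
  unknown counts. The second lets the block size range over the positive reals; a limit over the
  reals implies the one along natural numbers.\<close>

theorem lemma4p3:
  fixes F A :: "real \<Rightarrow> real"
    and unknowns :: "'op \<Rightarrow> nat"
    and R c\<^sub>F c\<^sub>A \<alpha> \<beta> :: real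
    and L :: nat
  assumes "R > 0" and "L \<ge> 1"
  shows
    "(\<forall>(blocks :: 'op list) (glob :: 'op) (N\<^sub>b :: nat) (N\<^sub>g :: nat).
        N\<^sub>b > 0 \<longrightarrow> R = real N\<^sub>g / real N\<^sub>b \<longrightarrow>
        length blocks = L \<longrightarrow> (\<forall>B\<in>set blocks. unknowns B = N\<^sub>b) \<longrightarrow> reusable blocks \<longrightarrow>
        unknowns glob = N\<^sub>g \<longrightarrow>
          solve_cost F A unknowns blocks = C_block F A (real N\<^sub>b) L \<and>
          solve_cost F A unknowns [glob] = C_global F A (real N\<^sub>b) R) \<and>
     (c\<^sub>F > 0 \<longrightarrow> c\<^sub>A > 0 \<longrightarrow> \<alpha> \<ge> \<beta> \<longrightarrow>
      (\<forall>N>0. F N = c\<^sub>F * N powr \<alpha>) \<longrightarrow> (\<forall>N>0. A N = c\<^sub>A * N powr \<beta>) \<longrightarrow>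
        (\<forall>N\<^sub>b>0. C_global F A N\<^sub>b R / C_block F A N\<^sub>b L =
           (c\<^sub>F * R powr \<alpha> * N\<^sub>b powr \<alpha> + c\<^sub>A * R powr \<beta> * N\<^sub>b powr \<beta>) /
           (c\<^sub>F * N\<^sub>b powr \<alpha> + c\<^sub>A * real L * N\<^sub>b powr \<beta>)) \<and>
        (\<alpha> > \<beta> \<longrightarrow>
           ((\<lambda>N\<^sub>b. C_global F A N\<^sub>b R / C_block F A N\<^sub>b L) \<longlongrightarrow> R powr \<alpha>) at_top))"
proof (intro conjI allI impI)
  fix blocks :: "'op list" and glob :: 'op and N\<^sub>b N\<^sub>g :: nat
  assume "N\<^sub>b > 0" and "R = real N\<^sub>g / real N\<^sub>b" and "length blocks = L"
    and "\<forall>B\<in>set blocks. unknowns B = N\<^sub>b" and "reusable blocks" and "unknowns glob = N\<^sub>g"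
  \<comment> \<open>\<open>L \<ge> 1\<close> makes \<open>blocks\<close> nonempty, and
    \<open>N\<^sub>b > 0\<close> turns the definition of the ratio into
    \<open>R * N\<^sub>b = N\<^sub>g\<close>.\<close>
  then show "solve_cost F A unknowns blocks = C_block F A (real N\<^sub>b) L"
    and "solve_cost F A unknowns [glob] = C_global F A (real N\<^sub>b) R"
    using \<open>L \<ge> 1\<close> solve_cost_reusable[of blocks unknowns "N\<^sub>b" F A]
    by (fastforce simp: solve_cost_single C_global_def)+
next
  assume powers: "\<forall>N>0. F N = c\<^sub>F * N powr \<alpha>" "\<forall>N>0. A N = c\<^sub>A * N powr \<beta>"
  note ratio = cost_ratio_power[OF powers \<open>R > 0\<close>]
  show "C_global F A N R / C_block F A N L =
      (c\<^sub>F * R powr \<alpha> * N powr \<alpha> + c\<^sub>A * R powr \<beta> * N powr \<beta>) /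
      (c\<^sub>F * N powr \<alpha> + c\<^sub>A * real L * N powr \<beta>)" if "N > 0" for N
    using that by (rule ratio)
  assume "c\<^sub>F > 0" and "\<alpha> > \<beta>"
  \<comment> \<open>With leading coefficients \<open>c\<^sub>F * R powr \<alpha>\<close> and
    \<open>c\<^sub>F\<close>, the positive factor \<open>c\<^sub>F\<close> cancels in the
    limit.\<close>
  then have "((\<lambda>N. (c\<^sub>F * R powr \<alpha> * N powr \<alpha> + c\<^sub>A * R powr \<beta> * N powr \<beta>) /
      (c\<^sub>F * N powr \<alpha> + c\<^sub>A * real L * N powr \<beta>)) \<longlongrightarrow> R powr \<alpha>) at_top"
    using tendsto_powr_ratio_at_top[of c\<^sub>F \<beta> \<alpha> "c\<^sub>F * R powr \<alpha>"] by simp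
  \<comment> \<open>The closed form is available only for \<open>N > 0\<close>, which is enough for
    a limit at infinity.\<close>
  moreover have "\<forall>\<^sub>F N in at_top. C_global F A N R / C_block F A N L =
      (c\<^sub>F * R powr \<alpha> * N powr \<alpha> + c\<^sub>A * R powr \<beta> * N powr \<beta>) /
      (c\<^sub>F * N powr \<alpha> + c\<^sub>A * real L * N powr \<beta>)"
    using eventually_gt_at_top[of 0] by eventually_elim (rule ratio)
  ultimately show "((\<lambda>N. C_global F A N R / C_block F A N L) \<longlongrightarrow> R powr \<alpha>) at_top"
    by (simp add: tendsto_cong)
qed

end
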